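(* Let $\mathsf{A}\subseteq\Phi_\omega$ be a bounded downset of constructive ordinals such that $\mathsf{A}\not\subseteq\mathsf{D}_\omega$. Then $\mathcal{E}_{l(\mathsf{A})+2}\subseteq\mathrm{PredR}_{\mathsf{A}}$.
   Context: Constructive ordinals: $\Omega$ is the set of infinitary terms generated by $0$, successor $\alpha+1$, and limits $\langle\alpha_i\rangle_{i\in\mathbb{N}}$; equality is syntactic. $\prec$ is the transitive closure of $\alpha\prec\alpha+1$ and $\alpha_m\prec\langle\alpha_i\rangle_i$; downsets are subsets closed downward under $\prec$; $\mathsf{D}_\alpha=\{\beta:\beta\prec\alpha\}$. $o(0)=0$, $o(n+1)=o(n)+1$, $\omega=\langle o(i+1)\rangle_i$. Arithmetic: $\alpha+0=\alpha$, $\alpha+(\beta+1)=(\alpha+\beta)+1$, $\alpha+\langle\beta_i\rangle=\langle\alpha+\beta_i\rangle$; $\alpha\cdot0=0$, $\alpha\cdot(\beta+1)=\alpha\cdot\beta+\alpha$, $\alpha\cdot\langle\beta_i\rangle=\langle\alpha\cdot\beta_i\rangle$; $\alpha^0=o(1)$, $\alpha^{\beta+1}=\alpha^\beta\cdot\alpha$, $\alpha^{\langle\beta_i\rangle}=\langle\alpha^{\beta_i}\rangle$. Veblen functions: $\phi_0(\gamma)=\omega^\gamma$; $\phi_{k+1}(0)=\langle\phi_k^{(i)}(0)\rangle_i$; $\phi_{k+1}(\gamma+1)=\langle\phi_k^{(i)}(\phi_{k+1}(\gamma)+1)\rangle_i$; $\phi_{k+1}(\langle\gamma_i\rangle)=\langle\phi_{k+1}(\gamma_i)\rangle_i$.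 $\Phi_\omega$ (resp. $\Phi_k$): smallest set containing $0$ closed under $+$ and all $\phi_i$ (resp. $\phi_i$, $i<k$). $\Psi_\omega$: closure of $\{0\}\cup\{\omega^{o(p)}:p\in\mathbb{N}\}$ under $+$. A downset $\mathsf{A}\subseteq\Phi_\omega$ is bounded if $\mathsf{A}\subseteq\Phi_k$ for some $k\ge1$; then $l(\mathsf{A})=0$ if $\mathsf{A}\subseteq\Psi_\omega$, else the least $k\ge1$ with $\mathsf{A}\subseteq\Phi_k$. $\mathcal{C}_{\mathsf{A}}$: functions $f(\bar\mu,\bar n;\bar a)$ (ordinal arguments in $\mathsf{A}$, normal numeral arguments $\bar n$, safe numeral arguments $\bar a$, values in $\mathbb{N}$); smallest class containing nullary $0$, projections onto numeral arguments, $s(;a)=a+1$, $P(;0)=0$, $P(;a+1)=a$, $C(;a,b,c)=b$ if $a=0$ else $c$, closed under predicative ordinal recursion ($f(0,\bar\nu,\bar n;\bar a)=g(\bar\nu,\bar n;\bar a)$, $f(\mu+1,\bar\nu,\bar n;\bar a)=h_{suc}(\mu,\bar\nu,\bar n;f(\mu,\bar\nu,\bar n;\bar a),\bar a)$, $f(\langle\mu_i\rangle,\bar\nu,\bar n;\bar a)=h_{lim}(\langle\mu_i\rangle,\bar\nu,\bar n;f(\mu_{q(\bar n;)},\bar\nu,\bar n;\bar a),\bar a)$, $q$ with only normal numeral arguments), safe composition $f(\bar\mu,\bar n;\bar a)=h(\bar\mu,\bar s(\bar\mu,\bar n;);\bar t(\bar\mu,\bar n;\bar a))$, substitution of a constant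 in $\mathsf{A}$ for an ordinal argument, and exchange/weakening/contraction of ordinal arguments. $\mathrm{PredR}_{\mathsf{A}}$: the $f:\mathbb{N}^k\to\mathbb{N}$ with $f(\bar n)=\hat f(\bar n;)$ for some $\hat f\in\mathcal{C}_{\mathsf{A}}$ with no ordinal and no safe arguments. Grzegorczyk hierarchy: $h_1(n)=n^2+2$, $h_{k+1}(n)=h_k^{(n)}(2)$; $\mathcal{E}_k$ ($k\ge2$) is the closure of zero, successor, projections and $h_1,\dots,h_{k-1}$ under composition and bounded primitive recursion. *)

theory Defs
  imports Main
begin

datatype cord = OZero | OSuc cord | OLim "nat \<Rightarrow> cord"

inductive prec1 :: "cord \<Rightarrow> cord \<Rightarrow> bool" where
  "prec1 \<alpha> (OSuc \<alpha>)"
| "prec1 (\<alpha> m) (OLim \<alpha>)"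

abbreviation prec :: "cord \<Rightarrow> cord \<Rightarrow> bool"  (infix "\<prec>" 50) where
  "\<alpha> \<prec> \<beta> \<equiv> prec1\<^sup>+\<^sup>+ \<alpha> \<beta>"

definition downset :: "cord set \<Rightarrow> bool" where
  "downset A \<longleftrightarrow> (\<forall>\<alpha>\<in>A. \<forall>\<beta>. \<beta> \<prec> \<alpha> \<longrightarrow> \<beta> \<in> A)"

definition D :: "cord \<Rightarrow> cord set" where
  "D \<alpha> = {\<beta>. \<beta> \<prec> \<alpha>}"

primrec onat :: "nat \<Rightarrow> cord" where
  "onat 0 = OZero"
| "onat (Suc n) = OSuc (onat n)"

definition omega :: cord where
  "omega = OLim (\<lambda>i. onat (i + 1))"

primrec oadd :: "cord \<Rightarrow> cord \<Rightarrow> cord" where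
  "oadd \<alpha> OZero = \<alpha>"
| "oadd \<alpha> (OSuc \<beta>) = OSuc (oadd \<alpha> \<beta>)"
| "oadd \<alpha> (OLim \<beta>) = OLim (\<lambda>i. oadd \<alpha> (\<beta> i))"

primrec omul :: "cord \<Rightarrow> cord \<Rightarrow> cord" where
  "omul \<alpha> OZero = OZero"
| "omul \<alpha> (OSuc \<beta>) = oadd (omul \<alpha> \<beta>) \<alpha>"
| "omul \<alpha> (OLim \<beta>) = OLim (\<lambda>i. omul \<alpha> (\<beta> i))"

primrec oexp :: "cord \<Rightarrow> cord \<Rightarrow> cord" where
  "oexp \<alpha> OZero = onat 1"
| "oexp \<alpha> (OSuc \<beta>) = omul (oexp \<alpha> \<beta>) \<alpha>"
| "oexp \<alpha> (OLim \<beta>) = OLim (\<lambda>i. oexp \<alpha> (\<beta> i))"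

primrec veblen_next :: "(cord \<Rightarrow> cord) \<Rightarrow> cord \<Rightarrow> cord" where
  "veblen_next f OZero = OLim (\<lambda>i. (f ^^ i) OZero)"
| "veblen_next f (OSuc \<gamma>) = OLim (\<lambda>i. (f ^^ i) (OSuc (veblen_next f \<gamma>)))"
| "veblen_next f (OLim \<gamma>) = OLim (\<lambda>i. veblen_next f (\<gamma> i))"

primrec veblen :: "nat \<Rightarrow> cord \<Rightarrow> cord" where
  "veblen 0 = oexp omega"
| "veblen (Suc k) = veblen_next (veblen k)"

inductive_set veblen_closure :: "nat set \<Rightarrow> cord set" for I :: "nat set" where
  "OZero \<in> veblen_closure I"
| "\<lbrakk>\<alpha> \<in> veblen_closure I; \<beta> \<in> veblen_closure I\<rbrakk> \<Longrightarrow> oadd \<alpha> \<beta> \<in> veblen_closure I"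
| "\<lbrakk>i \<in> I; \<alpha> \<in> veblen_closure I\<rbrakk> \<Longrightarrow> veblen i \<alpha> \<in> veblen_closure I"

definition Phi_omega :: "cord set" where
  "Phi_omega = veblen_closure UNIV"

definition Phi :: "nat \<Rightarrow> cord set" where
  "Phi k = veblen_closure {..<k}"

inductive_set Psi_omega :: "cord set" where
  "OZero \<in> Psi_omega"
| "oexp omega (onat p) \<in> Psi_omega"
| "\<lbrakk>\<alpha> \<in> Psi_omega; \<beta> \<in> Psi_omega\<rbrakk> \<Longrightarrow> oadd \<alpha> \<beta> \<in> Psi_omega"

definition bounded_ord :: "cord set \<Rightarrow> bool" where
  "bounded_ord A \<longleftrightarrow> (\<exists>k\<ge>1. A \<subseteq> Phi k)"

definition level :: "cord set \<Rightarrow> nat" where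
  "level A = (if A \<subseteq> Psi_omega then 0 else (LEAST k. k \<ge> 1 \<and> A \<subseteq> Phi k))"

text \<open>
  Argument tuples are lists, so the intended domain of a function with \<open>p\<close> ordinal, \<open>m\<close> normal
  and \<open>k\<close> safe arguments consists of the following triples.  Values off this domain carry no
  meaning: the rule \<open>dom_ext\<close> below (and likewise the one for the Grzegorczyk classes) identifies
  functions that agree on their domain.
\<close>

definition args :: "cord set \<Rightarrow> nat \<Rightarrow> nat \<Rightarrow> nat \<Rightarrow> (cord list \<times> nat list \<times> nat list) set" where
  "args A p m k = {(\<mu>, n, a). length \<mu> = p \<and> set \<mu> \<subseteq> A \<and> length n = m \<and> length a = k}"

text \<open>\<open>pred_class A p m k f\<close>: the function \<open>f(\<mu>, n; a)\<close> with \<open>p\<close> ordinal, \<open>m\<close> normal and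
  \<open>k\<close> safe arguments belongs to the class over \<open>A\<close>.\<close>

inductive pred_class ::
  "cord set \<Rightarrow> nat \<Rightarrow> nat \<Rightarrow> nat \<Rightarrow> (cord list \<Rightarrow> nat list \<Rightarrow> nat list \<Rightarrow> nat) \<Rightarrow> bool"
  for A :: "cord set" where
  zero: "pred_class A 0 0 0 (\<lambda>\<mu> n a. 0)"
| proj_normal: "i < m \<Longrightarrow> pred_class A p m k (\<lambda>\<mu> n a. n ! i)"
| proj_safe: "i < k \<Longrightarrow> pred_class A p m k (\<lambda>\<mu> n a. a ! i)"
| succ: "pred_class A 0 0 1 (\<lambda>\<mu> n a. a ! 0 + 1)"
| pred: "pred_class A 0 0 1 (\<lambda>\<mu> n a. case a ! 0 of 0 \<Rightarrow> 0 | Suc b \<Rightarrow> b)"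
| cond: "pred_class A 0 0 3 (\<lambda>\<mu> n a. if a ! 0 = 0 then a ! 1 else a ! 2)"
| ord_rec:
    "\<lbrakk>pred_class A p m k g;
      pred_class A (Suc p) m (Suc k) hsuc;
      pred_class A (Suc p) m (Suc k) hlim;
      pred_class A 0 m 0 q;
      \<And>\<nu> n a. (OZero # \<nu>, n, a) \<in> args A (Suc p) m k \<Longrightarrow>
        f (OZero # \<nu>) n a = g \<nu> n a;
      \<And>\<mu> \<nu> n a. (OSuc \<mu> # \<nu>, n, a) \<in> args A (Suc p) m k \<Longrightarrow>
        f (OSuc \<mu> # \<nu>) n a = hsuc (\<mu> # \<nu>) n (f (\<mu> # \<nu>) n a # a);
      \<And>\<mu> \<nu> n a. (OLim \<mu> # \<nu>, n, a) \<in> args A (Suc p) m k \<Longrightarrow>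
        f (OLim \<mu> # \<nu>) n a = hlim (OLim \<mu> # \<nu>) n (f (\<mu> (q [] n []) # \<nu>) n a # a)\<rbrakk>
     \<Longrightarrow> pred_class A (Suc p) m k f"
| safe_comp:
    "\<lbrakk>pred_class A p (length ss) (length ts) h;
      \<forall>s\<in>set ss. pred_class A p m 0 s;
      \<forall>t\<in>set ts. pred_class A p m k t\<rbrakk>
     \<Longrightarrow> pred_class A p m k (\<lambda>\<mu> n a. h \<mu> (map (\<lambda>s. s \<mu> n []) ss) (map (\<lambda>t. t \<mu> n a) ts))"
| const_subst:
    "\<lbrakk>pred_class A (Suc p) m k f; \<alpha> \<in> A\<rbrakk>
     \<Longrightarrow> pred_class A p m k (\<lambda>\<mu> n a. f (\<alpha> # \<mu>) n a)"
| exchange: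
    "\<lbrakk>pred_class A p m k f; Suc i < p\<rbrakk>
     \<Longrightarrow> pred_class A p m k (\<lambda>\<mu> n a. f (\<mu>[i := \<mu> ! Suc i, Suc i := \<mu> ! i]) n a)"
| weakening:
    "pred_class A p m k f \<Longrightarrow> pred_class A (Suc p) m k (\<lambda>\<mu> n a. f (tl \<mu>) n a)"
| contraction:
    "pred_class A (Suc (Suc p)) m k f
     \<Longrightarrow> pred_class A (Suc p) m k (\<lambda>\<mu> n a. f (hd \<mu> # \<mu>) n a)"
| dom_ext:
    "\<lbrakk>pred_class A p m k f; \<And>\<mu> n a. (\<mu>, n, a) \<in> args A p m k \<Longrightarrow> f' \<mu> n a = f \<mu> n a\<rbrakk>
     \<Longrightarrow> pred_class A p m k f'"

text \<open>A function on \<open>r\<close>-tuples of naturals is represented as a pair \<open>(r, f)\<close>, where only the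
  values of \<open>f\<close> on lists of length \<open>r\<close> matter.\<close>

definition PredR :: "cord set \<Rightarrow> (nat \<times> (nat list \<Rightarrow> nat)) set" where
  "PredR A = {(r, f). \<exists>f'. pred_class A 0 r 0 f' \<and> (\<forall>n. length n = r \<longrightarrow> f n = f' [] n [])}"

text \<open>The sequence of generating functions starts at index 1; the value at index 0 is a dummy.\<close>

fun grz_h :: "nat \<Rightarrow> nat \<Rightarrow> nat" where
  "grz_h 0 = (\<lambda>n. 0)"
| "grz_h (Suc 0) = (\<lambda>n. n ^ 2 + 2)"
| "grz_h (Suc (Suc k)) = (\<lambda>n. (grz_h (Suc k) ^^ n) 2)"

inductive_set Grz :: "nat \<Rightarrow> (nat \<times> (nat list \<Rightarrow> nat)) set" for k :: nat where
  zero: "(0, \<lambda>x. 0) \<in> Grz k"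
| succ: "(1, \<lambda>x. x ! 0 + 1) \<in> Grz k"
| proj: "i < r \<Longrightarrow> (r, \<lambda>x. x ! i) \<in> Grz k"
| gen: "\<lbrakk>1 \<le> j; j \<le> k - 1\<rbrakk> \<Longrightarrow> (1, \<lambda>x. grz_h j (x ! 0)) \<in> Grz k"
| comp:
    "\<lbrakk>(length gs, h) \<in> Grz k; \<forall>g\<in>set gs. (r, g) \<in> Grz k\<rbrakk>
     \<Longrightarrow> (r, \<lambda>x. h (map (\<lambda>g. g x) gs)) \<in> Grz k"
| bounded_rec:
    "\<lbrakk>(r, g) \<in> Grz k; (Suc (Suc r), h) \<in> Grz k; (Suc r, b) \<in> Grz k;
      \<And>x. length x = r \<Longrightarrow> f (0 # x) = g x;
      \<And>y x. length x = r \<Longrightarrow> f (Suc y # x) = h (y # f (y # x) # x);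
      \<And>y x. length x = r \<Longrightarrow> f (y # x) \<le> b (y # x)\<rbrakk>
     \<Longrightarrow> (Suc r, f) \<in> Grz k"
| dom_ext:
    "\<lbrakk>(r, f) \<in> Grz k; \<And>x. length x = r \<Longrightarrow> f' x = f x\<rbrakk> \<Longrightarrow> (r, f') \<in> Grz k"

end

theory Submission
  imports Defs
begin

text \<open>
  Recursion along \<open>\<alpha>\<close> with the limit index fixed to \<open>n\<close> performs as many successor steps as the
  value at \<open>n\<close> of the slow-growing function of \<open>\<alpha>\<close>. Slow-growing values are computed
  homomorphically from the arithmetic of ordinals, so an induction on the generation of \<open>\<Phi>\<^sub>\<omega>\<close>
  bounds them from below: an ordinal that is not a numeral grows at least like \<open>n\<close>, which turns
  ordinal recursion into predicative recursion on numbers; an ordinal outside \<open>\<Psi>\<^sub>\<omega>\<close> grows at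
  least like \<open>(n + 1)\<^sup>n\<close>; and an ordinal outside \<open>\<Phi>\<^sub>j\<close> grows fast enough to dominate the
  Grzegorczyk function \<open>h\<close> of index \<open>j + 2\<close>. As in the characterisations of Bellantoni and Cook,
  a bounded recursion is simulated with all its arguments in safe position, given one normal
  argument \<open>w\<close> that is large enough; for such a \<open>w\<close> an iterate of the dominating function is used.
\<close>

section \<open>Slow-growing functions of constructive ordinals\<close>

primrec slow :: "cord \<Rightarrow> nat \<Rightarrow> nat" where
  "slow OZero n = 0"
| "slow (OSuc \<alpha>) n = Suc (slow \<alpha> n)"
| "slow (OLim \<alpha>) n = slow (\<alpha> n) n"

lemma slow_onat [simp]: "slow (onat m) n = m"
  by (induction m) auto

lemma slow_omega [simp]: "slow omega n = Suc n"
  by (simp add: omega_def)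

lemma slow_oadd [simp]: "slow (oadd \<alpha> \<beta>) n = slow \<alpha> n + slow \<beta> n"
  by (induction \<beta>) auto

lemma slow_omul [simp]: "slow (omul \<alpha> \<beta>) n = slow \<alpha> n * slow \<beta> n"
  by (induction \<beta>) auto

lemma slow_oexp [simp]: "slow (oexp \<alpha> \<beta>) n = slow \<alpha> n ^ slow \<beta> n"
  by (induction \<beta>) auto

text \<open>Numeric image of the Veblen functions at index \<open>n\<close>: \<open>omega\<close>
  becomes \<open>Suc n\<close>, and a limit over iterates, read at \<open>n\<close>, becomes an
  \<open>n\<close>-fold iteration. Limit arguments leave no clause, since evaluation has already
  turned them into numbers.\<close>

primrec veblen_slow :: "nat \<Rightarrow> nat \<Rightarrow> nat \<Rightarrow> nat" where
  "veblen_slow 0 n = (\<lambda>x. Suc n ^ x)"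
| "veblen_slow (Suc k) n =
     rec_nat ((veblen_slow k n ^^ n) 0) (\<lambda>_ v. (veblen_slow k n ^^ n) (Suc v))"

lemma slow_veblen: "slow (veblen k \<gamma>) n = veblen_slow k n (slow \<gamma> n)"
proof (induction k arbitrary: \<gamma>)
  case (Suc k)
  have iter: "slow ((veblen k ^^ i) \<beta>) n = (veblen_slow k n ^^ i) (slow \<beta> n)" for i \<beta>
    by (induction i) (auto simp: Suc)
  show ?case
    by (induction \<gamma>) (auto simp: iter)
qed simp

section \<open>Growth and monotonicity of the numeric Veblen functions\<close>

lemma funpow_ge_add:
  fixes f :: "nat \<Rightarrow> nat"
  assumes "\<And>x. Suc x \<le> f x"
  shows "x + i \<le> (f ^^ i) x"
proof (induction i)
  case (Suc i)
  then show ?case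
    using assms[of "(f ^^ i) x"] by simp
qed simp

text \<open>At \<open>n = 0\<close> this fails: all powers are \<open>1\<close> and all iterations
  are empty.\<close>

lemma Suc_le_veblen_slow:
  assumes "n \<ge> 1"
  shows "Suc x \<le> veblen_slow k n x"
proof (induction k arbitrary: x)
  case 0
  have "x < Suc n ^ x"
    using assms by (intro power_gt_expt) auto
  then show ?case by simp
next
  case (Suc k)
  note ge = funpow_ge_add[of "veblen_slow k n", OF Suc]
  show ?case
  proof (induction x)
    case 0
    show ?case using ge[of 0 n] assms by simp
  next
    case (Suc x)
    then show ?case
      using ge[of "Suc (veblen_slow (Suc k) n x)" n] assms by simp
  qed
qed

lemma mono_funpow_nat:
  fixes f :: "nat \<Rightarrow> nat"
  assumes "mono f"
  shows "mono (f ^^ i)"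
  by (induction i) (use assms in \<open>auto simp: mono_def\<close>)

text \<open>The growth bound is missing at \<open>n = 0\<close>, hence the separate case: there
  level \<open>0\<close> is constant and every higher level is the identity.\<close>

lemma mono_veblen_slow: "mono (veblen_slow k n)"
proof (cases "n = 0")
  case True
  show ?thesis
  proof (cases k)
    case 0
    then show ?thesis using True by (simp add: mono_def)
  next
    case (Suc k')
    have "rec_nat 0 (\<lambda>_. Suc) x = x" for x :: nat
      by (induction x) auto
    then show ?thesis using True Suc by (simp add: mono_def)
  qed
next
  case False
  show ?thesis
  proof (cases k)
    case 0
    then show ?thesis by (auto simp: mono_def intro!: power_increasing)
  next
    case (Suc k')
    have "veblen_slow k n x \<le> veblen_slow k n (Suc x)" for x
      using funpow_ge_add[of "veblen_slow k' n" "Suc (veblen_slow k n x)" n]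
        Suc_le_veblen_slow[of n] False Suc by simp
    then show ?thesis
      by (simp add: mono_iff_le_Suc)
  qed
qed

text \<open>The next level at \<open>0\<close> is an iterate whose outermost application, by
  monotonicity, dominates the value of the lower level at \<open>0\<close>.\<close>

lemma veblen_slow_mono_index:
  assumes "n \<ge> 1" "j \<le> i"
  shows "veblen_slow j n 0 \<le> veblen_slow i n 0"
  using assms(2)
proof (induction i rule: dec_induct)
  case (step i)
  obtain n' where n: "n = Suc n'"
    using assms(1) by (cases n) auto
  have "veblen_slow i n 0 \<le> veblen_slow i n ((veblen_slow i n ^^ n') 0)"
    by (rule monoD[OF mono_veblen_slow]) simp
  also have "\<dots> = veblen_slow (Suc i) n 0"
    by (simp add: n)
  finally show ?case using step by simp
qed simp

text \<open>Turns not being a numeral into a growth rate. Sums of numerals are numerals, a nonzero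
  exponent of \<open>omega\<close> yields at least \<open>Suc n\<close>, and a Veblen function of
  positive index applies an inflationary map \<open>n\<close> times to \<open>0\<close>.\<close>

lemma Phi_omega_cases_slow:
  assumes "\<alpha> \<in> Phi_omega"
  shows "(\<exists>m. \<alpha> = onat m) \<or> (\<forall>n. n \<le> slow \<alpha> n)"
  using assms unfolding Phi_omega_def
proof (induction rule: veblen_closure.induct)
  case 1
  have "OZero = onat 0" by simp
  then show ?case by blast
next
  case (2 \<alpha> \<beta>)
  have "oadd (onat i) (onat j) = onat (i + j)" for i j
    by (induction j) auto
  then show ?case
    using 2 by (auto intro: trans_le_add1 trans_le_add2)
next
  case (3 i \<alpha>)
  show ?case
  proof (cases i)
    case 0
    show ?thesis
    proof (cases "\<alpha> = OZero")
      case True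
      then show ?thesis using 0 by (metis oexp.simps(1) veblen.simps(1))
    next
      case False
      have "n \<le> slow (veblen i \<alpha>) n" for n
      proof (cases "n = 0")
        case n: False
        \<comment> \<open>By the induction hypothesis \<open>\<alpha>\<close> is a positive numeral
          or has value at least \<open>n > 0\<close>.\<close>
        have "1 \<le> slow \<alpha> n"
          using 3(3) False n by (metis One_nat_def Suc_leI le_trans neq0_conv not_gr_zero
              onat.simps(1) slow_onat)
        then have "Suc n ^ 1 \<le> Suc n ^ slow \<alpha> n"
          by (intro power_increasing) auto
        then show ?thesis using 0 by simp
      qed simp
      then show ?thesis by blast
    qed
  next
    case (Suc i')
    have "n \<le> slow (veblen i \<alpha>) n" for n
    proof (cases "n = 0")
      case False
      have "0 + n \<le> (veblen_slow i' n ^^ n) 0"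
        by (rule funpow_ge_add) (use False Suc_le_veblen_slow in auto)
      also have "\<dots> = veblen_slow i n 0"
        by (simp add: Suc)
      also have "\<dots> \<le> veblen_slow i n (slow \<alpha> n)"
        by (rule monoD[OF mono_veblen_slow]) simp
      finally show ?thesis by (simp add: slow_veblen)
    qed simp
    then show ?thesis by blast
  qed
qed

text \<open>Outside \<open>Phi j\<close> some Veblen function of index at least \<open>j\<close>
  occurs in the generation; its value is large already at \<open>0\<close>, and the constructors
  applied afterwards never decrease it.\<close>

lemma slow_ge_outside_Phi:
  assumes "\<alpha> \<in> Phi_omega" "\<alpha> \<notin> Phi j" "n \<ge> 1"
  shows "veblen_slow j n 0 \<le> slow \<alpha> n"
  using assms(1,2) unfolding Phi_omega_def Phi_def
proof (induction rule: veblen_closure.induct)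
  case 1
  then show ?case by (auto intro: veblen_closure.intros)
next
  case (2 \<alpha> \<beta>)
  then show ?case
    by (metis slow_oadd trans_le_add1 trans_le_add2 veblen_closure.intros(2))
next
  case (3 i \<alpha>)
  show ?case
  proof (cases "i < j")
    case True
    then have "\<alpha> \<notin> veblen_closure {..<j}"
      using 3 by (auto intro: veblen_closure.intros)
    then have "veblen_slow j n 0 \<le> slow \<alpha> n"
      using 3 by blast
    also have "\<dots> \<le> slow (veblen i \<alpha>) n"
      using Suc_le_veblen_slow[OF assms(3), of "slow \<alpha> n" i] by (simp add: slow_veblen)
    finally show ?thesis .
  next
    case False
    then have "veblen_slow j n 0 \<le> veblen_slow i n 0"
      using assms(3) by (intro veblen_slow_mono_index) auto
    also have "\<dots> \<le> slow (veblen i \<alpha>) n"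
      unfolding slow_veblen by (rule monoD[OF mono_veblen_slow]) simp
    finally show ?thesis .
  qed
qed

text \<open>The bound \<open>n \<ge> 3\<close> is needed for \<open>\<phi>\<^sub>1(0)\<close>, which has slow-growing value \<open>n + 1\<close> at \<open>n = 2\<close>.\<close>

lemma slow_ge_outside_Psi_omega:
  assumes "\<alpha> \<in> Phi_omega" "\<alpha> \<notin> Psi_omega" "n \<ge> 3"
  shows "Suc n ^ n \<le> slow \<alpha> n"
  using assms(1,2) unfolding Phi_omega_def
proof (induction rule: veblen_closure.induct)
  case 1
  then show ?case by (auto intro: Psi_omega.intros)
next
  case (2 \<alpha> \<beta>)
  then show ?case
    by (metis Psi_omega.intros(3) slow_oadd trans_le_add1 trans_le_add2)
next
  case (3 i \<alpha>)
  show ?case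
  proof (cases i)
    case 0
    \<comment> \<open>A numeral exponent would put the power of \<open>omega\<close> into
      \<open>Psi_omega\<close>, so the exponent grows at least like \<open>n\<close>.\<close>
    have "\<nexists>m. \<alpha> = onat m"
      using 3 0 by (auto intro: Psi_omega.intros)
    then have "n \<le> slow \<alpha> n"
      using Phi_omega_cases_slow 3 by (auto simp: Phi_omega_def)
    then have "Suc n ^ n \<le> Suc n ^ slow \<alpha> n"
      by (intro power_increasing) auto
    then show ?thesis using 0 by simp
  next
    case (Suc i')
    \<comment> \<open>Three exponentials are split off the tower: the inner two already exceed
      \<open>n\<close>, so the outermost one has a large enough exponent.\<close>
    have "n = Suc (Suc (Suc (n - 3)))"
      using assms(3) by simp
    then obtain r where n: "n = Suc (Suc (Suc r))" by blast
    let ?t = "(veblen_slow 0 n ^^ r) 0"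
    have "Suc n ^ 1 \<le> Suc n ^ (Suc n ^ ?t)"
      by (intro power_increasing) auto
    then have "Suc n ^ n \<le> Suc n ^ (Suc n ^ (Suc n ^ ?t))"
      by (intro power_increasing) auto
    also have "\<dots> = (veblen_slow 0 n ^^ Suc (Suc (Suc r))) 0"
      by simp
    also have "\<dots> = veblen_slow (Suc 0) n 0"
      unfolding n[symmetric] by simp
    also have "\<dots> \<le> veblen_slow i n 0"
      using assms(3) Suc by (intro veblen_slow_mono_index) auto
    also have "\<dots> \<le> slow (veblen i \<alpha>) n"
      unfolding slow_veblen by (rule monoD[OF mono_veblen_slow]) simp
    finally show ?thesis .
  qed
qed

section \<open>Growth of the Grzegorczyk functions\<close>

lemma grz_h_Suc: "j \<ge> 1 \<Longrightarrow> grz_h (Suc j) n = (grz_h j ^^ n) 2"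
  by (cases j) auto

lemma Suc_le_square: "Suc n \<le> n ^ 2 + 2"
  by (cases n) (auto simp: power2_eq_square)

lemma Suc_le_grz_h:
  assumes "j \<ge> 1"
  shows "Suc n \<le> grz_h j n"
  using assms
proof (induction j arbitrary: n rule: dec_induct)
  case base
  show ?case using Suc_le_square by simp
next
  case (step j)
  have "2 + n \<le> (grz_h j ^^ n) 2"
    by (rule funpow_ge_add) (rule step.IH)
  then show ?case using step.hyps by (simp add: grz_h_Suc)
qed

lemma mono_grz_h:
  assumes "j \<ge> 1"
  shows "mono (grz_h j)"
proof (cases "j = 1")
  case True
  then show ?thesis by (auto simp: mono_def intro: power_mono)
next
  case False
  then obtain i where j: "j = Suc i" "i \<ge> 1"
    using assms by (cases j) auto
  have "grz_h j n \<le> grz_h j (Suc n)" for n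
    using Suc_le_grz_h[OF j(2), of "(grz_h i ^^ n) 2"] j by (simp add: grz_h_Suc)
  then show ?thesis by (simp add: mono_iff_le_Suc)
qed

text \<open>For \<open>n = Suc m\<close>, the value of \<open>grz_h (Suc j)\<close> is
  \<open>grz_h j\<close> at \<open>(grz_h j ^^ m) 2\<close>, which is at least \<open>n\<close>; at
  \<open>0\<close> all these functions equal \<open>2\<close>.\<close>

lemma grz_h_mono_index:
  assumes "1 \<le> i" "i \<le> j"
  shows "grz_h i n \<le> grz_h j n"
  using assms(2)
proof (induction j rule: dec_induct)
  case (step j)
  have j: "j \<ge> 1" using step assms(1) by simp
  have "grz_h j n \<le> grz_h (Suc j) n"
  proof (cases n)
    case 0
    have "grz_h j 0 = 2"
      using j by (cases j rule: grz_h.cases) auto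
    then show ?thesis using 0 j by (simp add: grz_h_Suc)
  next
    case (Suc m)
    have "n \<le> (grz_h j ^^ m) 2"
      using funpow_ge_add[of "grz_h j" 2 m] Suc_le_grz_h[OF j] Suc by simp
    then have "grz_h j n \<le> grz_h j ((grz_h j ^^ m) 2)"
      by (rule monoD[OF mono_grz_h[OF j]])
    then show ?thesis using Suc j by (simp add: grz_h_Suc)
  qed
  then show ?case using step by simp
qed simp

lemma double_le_grz_h:
  assumes "j \<ge> 1"
  shows "2 * n \<le> grz_h j n"
proof -
  have "2 * n \<le> n ^ 2 + 2"
  proof (cases "n \<ge> 2")
    case True
    then have "2 * n \<le> n ^ 2"
      unfolding power2_eq_square by (rule mult_le_mono1)
    then show ?thesis by (rule trans_le_add1)
  next
    case False
    then show ?thesis by (simp add: power2_eq_square)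
  qed
  also have "\<dots> \<le> grz_h j n"
    using grz_h_mono_index[of 1 j n] assms by simp
  finally show ?thesis .
qed

section \<open>Comparison of Grzegorczyk and numeric Veblen functions\<close>

lemma funpow_le_funpow:
  fixes f g :: "nat \<Rightarrow> nat"
  assumes "mono g" "\<And>x. f x \<le> g x"
  shows "(f ^^ i) x \<le> (g ^^ i) x"
proof (induction i)
  case (Suc i)
  then show ?case
    using assms(2)[of "(f ^^ i) x"] monoD[OF assms(1) Suc] by simp
qed simp

lemma funpow_le_exponent:
  fixes f :: "nat \<Rightarrow> nat"
  assumes "\<And>x. x \<le> f x" "i \<le> j"
  shows "(f ^^ i) x \<le> (f ^^ j) x"
  using assms(2) by (induction j rule: dec_induct) (auto intro: order.trans assms(1))

text \<open>For \<open>x \<ge> 2\<close> the step \<open>x ^ 2 + 2\<close> is at most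
  \<open>x ^ 3\<close>, so each iteration at most triples the exponent of \<open>2\<close>.\<close>

lemma grz_h_2_le: "grz_h 2 n \<le> 2 ^ 3 ^ n"
proof -
  have "(grz_h 1 ^^ n) 2 \<le> 2 ^ 3 ^ n"
  proof (induction n)
    case (Suc n)
    let ?x = "2 ^ 3 ^ n :: nat"
    have two: "2 ^ 1 \<le> ?x"
      by (intro power_increasing) auto
    have "(grz_h 1 ^^ Suc n) 2 \<le> ?x ^ 2 + 2"
      using Suc by (simp add: power_mono)
    also have "\<dots> \<le> ?x ^ 2 + ?x ^ 2"
      using two power_increasing[of 1 2 ?x] by simp
    also have "\<dots> = 2 * ?x ^ 2" by simp
    also have "\<dots> \<le> ?x * ?x ^ 2"
      using two by (intro mult_le_mono1) simp
    also have "\<dots> = ?x ^ 3"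
      by (simp add: power2_eq_square power3_eq_cube)
    also have "\<dots> = 2 ^ 3 ^ Suc n"
      by (simp add: power_mult mult.commute flip: power_mult)
    finally show ?case .
  qed simp
  then show ?thesis
    using grz_h_Suc[of 1 n] by (simp add: numeral_2_eq_2)
qed

text \<open>Each of the \<open>Suc x\<close> stages applies the lower function \<open>n\<close>
  times, and \<open>n \<ge> 2\<close> makes \<open>n * Suc x\<close> reach
  \<open>2 * x + 2\<close>.\<close>

lemma funpow_le_veblen_slow_Suc:
  assumes "n \<ge> 2"
  shows "(veblen_slow k n ^^ (2 * x + 2)) 0 \<le> veblen_slow (Suc k) n x"
proof -
  let ?f = "veblen_slow k n"
  have "(?f ^^ (n * Suc x)) 0 \<le> veblen_slow (Suc k) n x"
  proof (induction x)
    case (Suc x)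
    have "(?f ^^ (n * Suc (Suc x))) 0 = (?f ^^ n) ((?f ^^ (n * Suc x)) 0)"
      by (simp add: funpow_add)
    also have "\<dots> \<le> (?f ^^ n) (Suc (veblen_slow (Suc k) n x))"
      using Suc by (intro monoD[OF mono_funpow_nat[OF mono_veblen_slow]]) simp
    finally show ?case by simp
  qed simp
  moreover have "2 * x + 2 \<le> n * Suc x"
    using mult_le_mono1[OF assms, of "Suc x"] by simp
  then have "(?f ^^ (2 * x + 2)) 0 \<le> (?f ^^ (n * Suc x)) 0"
    using Suc_le_veblen_slow[of n] assms
    by (intro funpow_le_exponent) (auto intro: Suc_leD)
  ultimately show ?thesis by simp
qed

text \<open>Each of the \<open>x\<close> iterations costs two applications of \<open>f\<close>; two
  more lift \<open>0\<close> to at least the starting value \<open>2\<close>.\<close>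

lemma grz_h_Suc_le_funpow:
  fixes f :: "nat \<Rightarrow> nat"
  assumes "j \<ge> 1" "mono f" "\<And>x. Suc x \<le> f x" "\<And>x. grz_h j x \<le> f (f x)"
  shows "grz_h (Suc j) x \<le> (f ^^ (2 * x + 2)) 0"
proof -
  have "mono (f \<circ> f)"
    using assms(2) by (simp add: mono_def)
  then have "(grz_h j ^^ x) 2 \<le> ((f \<circ> f) ^^ x) 2"
    using assms(4) by (intro funpow_le_funpow) auto
  also have "f \<circ> f = f ^^ 2"
    by (simp add: numeral_2_eq_2)
  also have "((f ^^ 2) ^^ x) 2 = (f ^^ (2 * x)) 2"
    by (simp add: funpow_mult mult.commute)
  also have "\<dots> \<le> (f ^^ (2 * x)) ((f ^^ 2) 0)"
    using funpow_ge_add[of f 0 2, OF assms(3)]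
    by (intro monoD[OF mono_funpow_nat[OF assms(2)]]) simp
  also have "\<dots> = (f ^^ (2 * x + 2)) 0"
    by (simp only: funpow_add comp_def)
  finally show ?thesis using assms(1) by (simp add: grz_h_Suc)
qed

text \<open>Two applications are used because \<open>grz_h 2\<close> is bounded by a double
  exponential, while level \<open>0\<close> is a single one.\<close>

lemma grz_h_le_veblen_slow:
  assumes "n \<ge> 2"
  shows "grz_h (k + 2) x \<le> veblen_slow k n (veblen_slow k n x)"
proof (induction k arbitrary: x)
  case 0
  have "(2::nat) ^ 3 ^ x \<le> Suc n ^ Suc n ^ x"
  proof (rule order.trans)
    show "(2::nat) ^ 3 ^ x \<le> 2 ^ Suc n ^ x"
      using assms by (intro power_increasing power_mono) auto
    show "(2::nat) ^ Suc n ^ x \<le> Suc n ^ Suc n ^ x"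
      using assms by (intro power_mono) auto
  qed
  then show ?case using grz_h_2_le[of x] by (simp add: numeral_2_eq_2)
next
  case (Suc k)
  have "grz_h (Suc (k + 2)) x \<le> (veblen_slow k n ^^ (2 * x + 2)) 0"
    using assms Suc by (intro grz_h_Suc_le_funpow mono_veblen_slow Suc_le_veblen_slow) auto
  also have "\<dots> \<le> veblen_slow (Suc k) n x"
    by (rule funpow_le_veblen_slow_Suc[OF assms])
  also have "\<dots> \<le> veblen_slow (Suc k) n (veblen_slow (Suc k) n x)"
    using Suc_le_veblen_slow[of n "veblen_slow (Suc k) n x" "Suc k"] assms by simp
  finally show ?case by simp
qed

text \<open>Diagonalisation: at argument \<open>0\<close> the index is also the number of
  iterations, so it is set to the required \<open>2 * x + 2\<close>.\<close>

lemma grz_h_le_veblen_slow_zero: "grz_h (k + 3) x \<le> veblen_slow (Suc k) (2 * x + 2) 0"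
proof -
  have "grz_h (Suc (k + 2)) x \<le> (veblen_slow k (2 * x + 2) ^^ (2 * x + 2)) 0"
    by (intro grz_h_Suc_le_funpow mono_veblen_slow Suc_le_veblen_slow grz_h_le_veblen_slow) auto
  then show ?thesis by (simp add: eval_nat_numeral)
qed

section \<open>Predicative recursion on numbers\<close>

lemma pred_class_comp:
  assumes "pred_class A p m' k' h" "m' = length ss" "k' = length ts"
    and "\<And>s. s \<in> set ss \<Longrightarrow> pred_class A p m 0 s"
    and "\<And>t. t \<in> set ts \<Longrightarrow> pred_class A p m k t"
    and "\<And>\<mu> n a. (\<mu>, n, a) \<in> args A p m k \<Longrightarrow>
      f \<mu> n a = h \<mu> (map (\<lambda>s. s \<mu> n []) ss) (map (\<lambda>t. t \<mu> n a) ts)"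
  shows "pred_class A p m k f"
proof (rule pred_class.dom_ext)
  show "pred_class A p m k (\<lambda>\<mu> n a. h \<mu> (map (\<lambda>s. s \<mu> n []) ss) (map (\<lambda>t. t \<mu> n a) ts))"
    using assms(1-5) by (intro pred_class.safe_comp) auto
qed (rule assms(6))

text \<open>Safe composition passes the ordinal arguments on unchanged, so the initial functions
  need dummy ones before they can be composed.\<close>

lemma pred_class_weaken_ord:
  assumes "pred_class A 0 m k f"
  shows "pred_class A p m k (\<lambda>\<mu> n a. f [] n a)"
proof (induction p)
  case 0
  show ?case
    using assms by (rule pred_class.dom_ext) (auto simp: args_def)
next
  case (Suc p)
  from pred_class.weakening[OF this] show ?case by simp
qed

lemma pred_class_Suc:
  assumes "pred_class A p m k t"
  shows "pred_class A p m k (\<lambda>\<mu> n a. Suc (t \<mu> n a))"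
  by (rule pred_class_comp[OF pred_class_weaken_ord[OF pred_class.succ],
        where ss = "[]" and ts = "[t]"]) (use assms in auto)

lemma pred_class_minus_one:
  assumes "pred_class A p m k t"
  shows "pred_class A p m k (\<lambda>\<mu> n a. t \<mu> n a - 1)"
  by (rule pred_class_comp[OF pred_class_weaken_ord[OF pred_class.pred],
        where ss = "[]" and ts = "[t]"]) (use assms in \<open>auto split: nat.split\<close>)

lemma pred_class_if:
  assumes "pred_class A p m k t" "pred_class A p m k u" "pred_class A p m k v"
  shows "pred_class A p m k (\<lambda>\<mu> n a. if t \<mu> n a = 0 then u \<mu> n a else v \<mu> n a)"
  by (rule pred_class_comp[OF pred_class_weaken_ord[OF pred_class.cond],
        where ss = "[]" and ts = "[t, u, v]"]) (use assms in auto)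

lemma pred_class_const: "pred_class A p m k (\<lambda>\<mu> n a. c)"
proof (induction c)
  case 0
  show ?case
    by (rule pred_class_comp[OF pred_class_weaken_ord[OF pred_class.zero],
          where ss = "[]" and ts = "[]"]) auto
next
  case (Suc c)
  then show ?case by (rule pred_class_Suc)
qed

text \<open>With \<open>q\<close> the first normal argument, ordinal recursion has exactly the
  clauses of \<open>slow\<close>.\<close>

lemma pred_class_slow:
  assumes "m > 0"
  shows "pred_class A (Suc 0) m k (\<lambda>\<mu> n a. slow (\<mu> ! 0) (n ! 0))"
  by (rule pred_class.ord_rec[where g = "\<lambda>\<mu> n a. 0" and hsuc = "\<lambda>\<mu> n a. Suc (a ! 0)"
        and hlim = "\<lambda>\<mu> n a. a ! 0" and q = "\<lambda>\<mu> n a. n ! 0"])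
    (use assms in \<open>auto intro: pred_class_const pred_class_Suc pred_class.proj_safe
        pred_class.proj_normal\<close>)

text \<open>Counting down along the ordinal gives this comparison before subtraction of numbers is
  available; it detects surplus recursion steps.\<close>

lemma pred_class_minus_slow:
  assumes "m > 0"
  shows "pred_class A (Suc 0) m k (\<lambda>\<mu> n a. n ! 0 - slow (\<mu> ! 0) (n ! 0))"
  by (rule pred_class.ord_rec[where g = "\<lambda>\<mu> n a. n ! 0" and hsuc = "\<lambda>\<mu> n a. a ! 0 - 1"
        and hlim = "\<lambda>\<mu> n a. a ! 0" and q = "\<lambda>\<mu> n a. n ! 0"])
    (use assms in \<open>auto intro: pred_class_minus_one[unfolded One_nat_def] pred_class.proj_safe
        pred_class.proj_normal\<close>)

lemma map_nth_length:
  assumes "length xs = m"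
  shows "map (\<lambda>i. xs ! i) [0..<m] = xs"
  using assms map_nth by metis

lemma map_nth_Suc:
  assumes "length xs = Suc m"
  shows "map (\<lambda>i. xs ! Suc i) [0..<m] = tl xs"
  using assms by (cases xs) (auto intro: nth_equalityI)

text \<open>The ordinal \<open>\<alpha>\<close> is the clock along which recursions on numbers are
  run.\<close>

locale superlinear_ord =
  fixes A :: "cord set" and \<alpha> :: cord
  assumes mem: "\<alpha> \<in> A" and le_slow: "n \<le> slow \<alpha> n"
begin

text \<open>
  The recursion along \<open>\<alpha>\<close> may take more steps than the value \<open>y\<close> of the recursion argument. The
  number of steps below the current ordinal \<open>\<mu>\<close> is \<open>slow \<mu> y\<close>, which is computable in normal
  position, so the surplus steps can be recognised and made idle.
\<close>

lemma pred_class_rec_nat: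
  assumes g: "pred_class A 0 m k g" and h: "pred_class A 0 (Suc m) (Suc k) h"
  shows "pred_class A 0 (Suc m) k
    (\<lambda>\<mu> n a. rec_nat (g [] (tl n) a) (\<lambda>j v. h [] (j # tl n) (v # a)) (hd n))"
proof -
  define R where "R = (\<lambda>n a. rec_nat (g [] (tl n) a) (\<lambda>j v. h [] (j # tl n) (v # a)))"
  \<comment> \<open>The minimum freezes the recursion after \<open>hd n\<close> steps, however many
    successors lie below.\<close>
  define f where "f = (\<lambda>\<mu> n a. R n a (min (hd n) (slow (hd \<mu>) (hd n))))"
  have "pred_class A (Suc 0) (Suc m) k f"
  proof (rule pred_class.ord_rec)
    show "pred_class A 0 (Suc m) k (\<lambda>\<mu> n a. g [] (tl n) a)"
      by (rule pred_class_comp[OF g, where ss = "map (\<lambda>i \<mu> n a. n ! Suc i) [0..<m]"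
            and ts = "map (\<lambda>i \<mu> n a. a ! i) [0..<k]"])
        (auto simp: args_def comp_def map_nth_Suc map_nth_length intro: pred_class.proj_safe
          pred_class.proj_normal)
    have "pred_class A (Suc 0) (Suc m) (Suc k) (\<lambda>\<mu> n b. h [] (slow (\<mu> ! 0) (n ! 0) # tl n) b)"
      by (rule pred_class_comp[OF pred_class_weaken_ord[OF h],
            where ss = "(\<lambda>\<mu> n a. slow (\<mu> ! 0) (n ! 0)) # map (\<lambda>i \<mu> n a. n ! Suc i) [0..<m]"
            and ts = "map (\<lambda>i \<mu> n a. a ! i) [0..<Suc k]"])
        (auto simp del: upt_Suc simp: args_def comp_def map_nth_Suc map_nth_length
          intro: pred_class.proj_safe pred_class.proj_normal pred_class_slow)
    \<comment> \<open>Difference \<open>0\<close> means that the recursion argument has been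
      reached, and the safe value is passed on.\<close>
    then show "pred_class A (Suc 0) (Suc m) (Suc k) (\<lambda>\<mu> n b.
        if n ! 0 - slow (\<mu> ! 0) (n ! 0) = 0 then b ! 0
        else h [] (slow (\<mu> ! 0) (n ! 0) # tl n) b)"
      by (intro pred_class_if pred_class_minus_slow pred_class.proj_safe) auto
    show "pred_class A (Suc 0) (Suc m) (Suc k) (\<lambda>\<mu> n a. a ! 0)"
      by (rule pred_class.proj_safe) simp
    show "pred_class A 0 (Suc m) 0 (\<lambda>\<mu> n a. n ! 0)"
      by (rule pred_class.proj_normal) simp
  next
    fix \<mu> \<nu> n a
    assume "(OSuc \<mu> # \<nu>, n, a) \<in> args A (Suc 0) (Suc m) k"
    then obtain y n' where n: "n = y # n'"
      by (cases n) (auto simp: args_def)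
    show "f (OSuc \<mu> # \<nu>) n a =
      (if n ! 0 - slow ((\<mu> # \<nu>) ! 0) (n ! 0) = 0 then (f (\<mu> # \<nu>) n a # a) ! 0
       else h [] (slow ((\<mu> # \<nu>) ! 0) (n ! 0) # tl n) (f (\<mu> # \<nu>) n a # a))"
    proof (cases "y \<le> slow \<mu> y")
      case True
      then have "min y (Suc (slow \<mu> y)) = y" "min y (slow \<mu> y) = y"
        by auto
      then show ?thesis using True by (simp add: f_def n)
    next
      case False
      then have "min y (Suc (slow \<mu> y)) = Suc (slow \<mu> y)" "min y (slow \<mu> y) = slow \<mu> y"
        by auto
      then show ?thesis using False by (simp add: f_def R_def n)
    qed
  next
    fix \<mu> \<nu> n a
    assume "(OLim \<mu> # \<nu>, n, a) \<in> args A (Suc 0) (Suc m) k"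
    then have "n ! 0 = hd n"
      by (cases n) (auto simp: args_def)
    then show "f (OLim \<mu> # \<nu>) n a = (f (\<mu> (n ! 0) # \<nu>) n a # a) ! 0"
      by (simp add: f_def)
  qed (simp add: f_def R_def)
  from pred_class.const_subst[OF this mem] show ?thesis
    unfolding f_def R_def list.sel min.absorb1[OF le_slow] .
qed

text \<open>The summand \<open>s\<close> controls the recursion and must be normal; only
  \<open>t\<close> may use safe arguments.\<close>

lemma pred_class_add:
  assumes "pred_class A p m 0 s" "pred_class A p m k t"
  shows "pred_class A p m k (\<lambda>\<mu> n a. s \<mu> n [] + t \<mu> n a)"
proof -
  have "pred_class A 0 (Suc 0) (Suc 0) (\<lambda>\<mu> n a. rec_nat (a ! 0) (\<lambda>j v. Suc v) (hd n))"
    using pred_class_rec_nat[of 0 "Suc 0" "\<lambda>\<mu> n a. a ! 0" "\<lambda>\<mu> n a. Suc (a ! 0)"]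
    by (simp add: pred_class_Suc pred_class.proj_safe)
  moreover have "rec_nat b (\<lambda>j. Suc) y = y + b" for b y
    by (induction y) auto
  ultimately have "pred_class A 0 (Suc 0) (Suc 0) (\<lambda>\<mu> n a. hd n + a ! 0)"
    by simp
  then show ?thesis
    by (rule pred_class_comp[OF pred_class_weaken_ord, where ss = "[s]" and ts = "[t]"])
      (use assms in auto)
qed

lemma pred_class_minus:
  assumes "pred_class A p m 0 s" "pred_class A p m k t"
  shows "pred_class A p m k (\<lambda>\<mu> n a. t \<mu> n a - s \<mu> n [])"
proof -
  have "pred_class A 0 (Suc 0) (Suc 0) (\<lambda>\<mu> n a. rec_nat (a ! 0) (\<lambda>j v. v - 1) (hd n))"
    using pred_class_rec_nat[of 0 "Suc 0" "\<lambda>\<mu> n a. a ! 0" "\<lambda>\<mu> n a. a ! 0 - 1"]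
    by (simp add: pred_class_minus_one[unfolded One_nat_def] pred_class.proj_safe)
  moreover have "rec_nat b (\<lambda>j v. v - 1) y = b - y" for b y :: nat
    by (induction y) auto
  ultimately have "pred_class A 0 (Suc 0) (Suc 0) (\<lambda>\<mu> n a. a ! 0 - hd n)"
    by simp
  then show ?thesis
    by (rule pred_class_comp[OF pred_class_weaken_ord, where ss = "[s]" and ts = "[t]"])
      (use assms in auto)
qed

text \<open>A normal number is added repeatedly to a safe accumulator starting at \<open>2\<close>;
  number of rounds and summand are then identified.\<close>

lemma pred_class_square_add_2: "pred_class A 0 (Suc 0) 0 (\<lambda>\<mu> n a. (n ! 0) ^ 2 + 2)"
proof -
  have step: "pred_class A 0 (Suc (Suc 0)) (Suc 0) (\<lambda>\<mu> n a. n ! 1 + a ! 0)"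
    by (rule pred_class_add[where s = "\<lambda>\<mu> n a. n ! 1"])
      (rule pred_class.proj_normal pred_class.proj_safe, simp)+
  have rec_eq: "rec_nat 2 (\<lambda>j v. x + v) y = y * x + 2" for x y :: nat
    by (induction y) auto
  show ?thesis
    by (rule pred_class_comp[OF pred_class_rec_nat[OF pred_class_const[of A 0 "Suc 0" 0 2] step],
          where ss = "[\<lambda>\<mu> n a. n ! 0, \<lambda>\<mu> n a. n ! 0]" and ts = "[]"])
      (auto simp: rec_eq power2_eq_square intro: pred_class.proj_normal)
qed

lemma pred_class_sum_list: "pred_class A 0 r 0 (\<lambda>\<mu> n a. sum_list n)"
proof -
  have "i \<le> r \<Longrightarrow> pred_class A 0 r 0 (\<lambda>\<mu> n a. \<Sum>j<i. n ! j)" for i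
  proof (induction i)
    case 0
    show ?case using pred_class_const[of A 0 r 0 0] by simp
  next
    case (Suc i)
    then have "pred_class A 0 r 0 (\<lambda>\<mu> n a. n ! i + (\<Sum>j<i. n ! j))"
      by (intro pred_class_add[where s = "\<lambda>\<mu> n a. n ! i"] pred_class.proj_normal) simp_all
    then show ?case by (simp add: add.commute)
  qed
  from this[OF order_refl] show ?thesis
    by (rule pred_class.dom_ext) (auto simp: args_def sum_list_sum_nth atLeast0LessThan)
qed

section \<open>Simulation with safe arguments\<close>

text \<open>Correctness for every \<open>w\<close> above the threshold \<open>W x\<close> lets
  several simulations share one large \<open>w\<close>.\<close>

definition simulable :: "nat \<Rightarrow> (nat list \<Rightarrow> nat) \<Rightarrow> (nat list \<Rightarrow> nat) \<Rightarrow> bool" where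
  "simulable r f W \<longleftrightarrow> (\<exists>f'. pred_class A 0 (Suc 0) r f' \<and>
    (\<forall>x w. length x = r \<longrightarrow> W x \<le> w \<longrightarrow> f' [] [w] x = f x))"

lemma simulable_mono:
  assumes "simulable r f W" "\<And>x. length x = r \<Longrightarrow> W x \<le> V x"
  shows "simulable r f V"
  using assms unfolding simulable_def by (meson order.trans)

lemma simulable_cong:
  assumes "simulable r f W" "\<And>x. length x = r \<Longrightarrow> f' x = f x"
  shows "simulable r f' W"
  using assms unfolding simulable_def by metis

lemma simulable_const: "simulable r (\<lambda>x. c) W"
  unfolding simulable_def using pred_class_const by blast

lemma simulable_proj: "i < r \<Longrightarrow> simulable r (\<lambda>x. x ! i) W"
  unfolding simulable_def using pred_class.proj_safe by blast

lemma simulable_Suc: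
  assumes "simulable r f W"
  shows "simulable r (\<lambda>x. Suc (f x)) W"
proof -
  obtain f' where "pred_class A 0 (Suc 0) r f'"
    "\<And>x w. length x = r \<Longrightarrow> W x \<le> w \<Longrightarrow> f' [] [w] x = f x"
    using assms unfolding simulable_def by blast
  then show ?thesis
    unfolding simulable_def
    by (intro exI[of _ "\<lambda>\<mu> n a. Suc (f' \<mu> n a)"]) (auto intro: pred_class_Suc)
qed

text \<open>All parts receive the same \<open>w\<close>; \<open>le\<close> makes it large enough for
  the outer function at the inner values.\<close>

lemma simulable_comp:
  assumes h: "simulable (length gs) h V" and gs: "\<And>g. g \<in> set gs \<Longrightarrow> simulable r g W"
    and le: "\<And>x. length x = r \<Longrightarrow> V (map (\<lambda>g. g x) gs) \<le> W x"
  shows "simulable r (\<lambda>x. h (map (\<lambda>g. g x) gs)) W"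
proof -
  obtain h' where h': "pred_class A 0 (Suc 0) (length gs) h'"
    "\<And>x w. length x = length gs \<Longrightarrow> V x \<le> w \<Longrightarrow> h' [] [w] x = h x"
    using h unfolding simulable_def by blast
  obtain F where F: "\<And>g. g \<in> set gs \<Longrightarrow> pred_class A 0 (Suc 0) r (F g)"
    "\<And>g x w. g \<in> set gs \<Longrightarrow> length x = r \<Longrightarrow> W x \<le> w \<Longrightarrow> F g [] [w] x = g x"
    using gs unfolding simulable_def by metis
  have "pred_class A 0 (Suc 0) r (\<lambda>\<mu> n a. h' \<mu> [n ! 0] (map (\<lambda>g. F g \<mu> n a) gs))"
    by (rule pred_class_comp[OF h'(1), where ss = "[\<lambda>\<mu> n a. n ! 0]" and ts = "map F gs"])
      (auto intro: pred_class.proj_normal F(1) simp: comp_def)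
  moreover have "h' [] [w] (map (\<lambda>g. F g [] [w] x) gs) = h (map (\<lambda>g. g x) gs)"
    if "length x = r" "W x \<le> w" for x w
  proof -
    have eq: "map (\<lambda>g. F g [] [w] x) gs = map (\<lambda>g. g x) gs"
      using F(2) that by simp
    show ?thesis
      unfolding eq using h'(2)[of "map (\<lambda>g. g x) gs" w] le[OF that(1)] that(2) by simp
  qed
  ultimately show ?thesis
    unfolding simulable_def by (intro exI conjI) auto
qed

text \<open>
  The recursion argument \<open>y\<close> is safe, so the recursion runs over \<open>u \<le> w\<close> instead; after \<open>u\<close>
  steps it has computed \<open>f\<close> at the first argument \<open>y - (w - u)\<close>, with truncated subtractions.
\<close>

lemma simulable_rec:
  assumes g: "simulable r g V" and h: "simulable (Suc (Suc r)) h W'"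
    and f0: "\<And>x. length x = r \<Longrightarrow> f (0 # x) = g x"
    and fSuc: "\<And>y x. length x = r \<Longrightarrow> f (Suc y # x) = h (y # f (y # x) # x)"
    and W_arg: "\<And>y x. length x = r \<Longrightarrow> y \<le> W (y # x)"
    and W_base: "\<And>y x. length x = r \<Longrightarrow> V x \<le> W (y # x)"
    and W_step: "\<And>j y x. length x = r \<Longrightarrow> j < y \<Longrightarrow> W' (j # f (j # x) # x) \<le> W (y # x)"
  shows "simulable (Suc r) f W"
proof -
  obtain g' where g': "pred_class A 0 (Suc 0) r g'"
    "\<And>x w. length x = r \<Longrightarrow> V x \<le> w \<Longrightarrow> g' [] [w] x = g x"
    using g unfolding simulable_def by blast
  obtain h' where h': "pred_class A 0 (Suc 0) (Suc (Suc r)) h'"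
    "\<And>x w. length x = Suc (Suc r) \<Longrightarrow> W' x \<le> w \<Longrightarrow> h' [] [w] x = h x"
    using h unfolding simulable_def by blast
  define G where "G = (\<lambda>(\<mu> :: cord list) n a. g' [] [n ! 0] (tl a))"
  \<comment> \<open>The normal arguments are the counter \<open>u\<close> and \<open>w\<close>; the
    safe ones are the current value, \<open>y\<close> and \<open>x\<close>. \<open>Y\<close> is the
    first argument reached after this step, hence \<open>0\<close> during the idle phase.\<close>
  define Y where "Y = (\<lambda>(\<mu> :: cord list) n a. a ! 1 - (n ! 1 - n ! 0 - 1 :: nat))"
  define H where "H = (\<lambda>\<mu> n a. if Y \<mu> n a = 0 then a ! 0
    else h' [] [n ! 1] ((Y \<mu> n a - 1) # a ! 0 # tl (tl a)))"
  define R where "R = (\<lambda>w a. rec_nat (G [] [w] a) (\<lambda>j v. H [] [j, w] (v # a)))"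
  have G: "pred_class A 0 (Suc 0) (Suc r) G"
    unfolding G_def
    by (rule pred_class_comp[OF pred_class_weaken_ord[OF g'(1)], where ss = "[\<lambda>\<mu> n a. n ! 0]"
          and ts = "map (\<lambda>i \<mu> n a. a ! Suc i) [0..<r]"])
      (auto simp: args_def comp_def map_nth_Suc intro: pred_class.proj_safe
        pred_class.proj_normal)
  have Y: "pred_class A 0 (Suc (Suc 0)) (Suc (Suc r)) Y"
    unfolding Y_def
    by (intro pred_class_minus[where s = "\<lambda>\<mu> n a. n ! 1 - n ! 0 - 1"] pred_class_minus_one
        pred_class_minus[where s = "\<lambda>\<mu> n a. n ! 0"]
        pred_class.proj_safe pred_class.proj_normal) auto
  have tl_tl: "map (\<lambda>i. a ! Suc (Suc i)) [0..<r] = tl (tl a)" if "length a = Suc (Suc r)"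
    for a :: "nat list"
    using that by (auto simp: nth_tl intro!: nth_equalityI)
  have "pred_class A 0 (Suc (Suc 0)) (Suc (Suc r))
      (\<lambda>\<mu> n a. h' [] [n ! 1] ((Y \<mu> n a - 1) # a ! 0 # tl (tl a)))"
    by (rule pred_class_comp[OF pred_class_weaken_ord[OF h'(1)], where ss = "[\<lambda>\<mu> n a. n ! 1]"
          and ts = "(\<lambda>\<mu> n a. Y \<mu> n a - 1) # (\<lambda>\<mu> n a. a ! 0) #
            map (\<lambda>i \<mu> n a. a ! Suc (Suc i)) [0..<r]"])
      (auto simp: args_def comp_def tl_tl intro: pred_class.proj_safe
        pred_class.proj_normal pred_class_minus_one[unfolded One_nat_def] Y)
  then have H: "pred_class A 0 (Suc (Suc 0)) (Suc (Suc r)) H"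
    unfolding H_def by (intro pred_class_if Y pred_class.proj_safe) auto
  from pred_class_rec_nat[OF G H]
  have rec: "pred_class A 0 (Suc (Suc 0)) (Suc r)
    (\<lambda>\<mu> n a. rec_nat (G [] (tl n) a) (\<lambda>j v. H [] (j # tl n) (v # a)) (hd n))" .
  \<comment> \<open>The single \<open>w\<close> is both the number of steps and the
    parameter.\<close>
  have "pred_class A 0 (Suc 0) (Suc r) (\<lambda>\<mu> n a. R (n ! 0) a (n ! 0))"
    by (rule pred_class_comp[OF rec, where ss = "[\<lambda>\<mu> n a. n ! 0, \<lambda>\<mu> n a. n ! 0]"
          and ts = "map (\<lambda>i \<mu> n a. a ! i) [0..<Suc r]"])
      (auto simp del: upt_Suc simp: R_def args_def comp_def map_nth_length
        intro: pred_class.proj_safe pred_class.proj_normal)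
  moreover have "R w z w = f z" if z: "length z = Suc r" and w: "W z \<le> w" for w z
  proof -
    obtain y x where yx: "z = y # x" and x: "length x = r"
      using z by (cases z) auto
    \<comment> \<open>Hence the truncated \<open>y - w\<close> is \<open>0\<close> and the run
      starts from the base value.\<close>
    have y: "y \<le> w"
      using W_arg[OF x, of y] w yx by simp
    have "u \<le> w \<Longrightarrow> R w (y # x) u = f ((y - (w - u)) # x)" for u
    proof (induction u)
      case 0
      have "V x \<le> w"
        using W_base[OF x, of y] w yx by simp
      then show ?case
        using y x by (simp add: R_def G_def g'(2) f0)
    next
      case (Suc u)
      have IH: "R w (y # x) u = f ((y - (w - u)) # x)"
        using Suc by simp
      have step: "R w (y # x) (Suc u) = H [] [u, w] (R w (y # x) u # y # x)"
        by (simp add: R_def)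
      show ?case
      proof (cases "y - (w - u - 1) = 0")
        case True
        then show ?thesis
          by (simp add: step H_def Y_def IH)
      next
        case False
        define j where "j = y - (w - u)"
        have j: "y - (w - Suc u) = Suc j" "j < y"
          using False Suc.prems y unfolding j_def by auto
        have "W' (j # f (j # x) # x) \<le> w"
          using W_step[OF x j(2)] w yx by simp
        moreover have "\<not> y \<le> w - Suc u"
          using j(1) by simp
        ultimately show ?thesis
          using j x IH by (simp add: step H_def Y_def h'(2) fSuc flip: j_def)
      qed
    qed
    from this[of w] show ?thesis by (simp add: yx)
  qed
  ultimately show ?thesis
    unfolding simulable_def by (intro exI conjI) auto
qed

section \<open>Simulation of the Grzegorczyk classes\<close>

lemma simulable_add: "simulable (Suc (Suc 0)) (\<lambda>z. z ! 0 + z ! 1) sum_list"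
proof (rule simulable_rec)
  show "simulable (Suc 0) (\<lambda>z. z ! 0) (\<lambda>_. 0)"
    by (rule simulable_proj) simp
  show "simulable (Suc (Suc (Suc 0))) (\<lambda>z. Suc (z ! 1)) (\<lambda>_. 0)"
    by (intro simulable_Suc simulable_proj) simp
qed auto

text \<open>In the threshold the product covers the additions, and the extra \<open>z ! 0\<close>
  covers the recursion argument when the other factor is \<open>0\<close>.\<close>

lemma simulable_mult:
  "simulable (Suc (Suc 0)) (\<lambda>z. z ! 0 * z ! 1) (\<lambda>z. z ! 0 * z ! 1 + z ! 0)"
proof (rule simulable_rec)
  show "simulable (Suc 0) (\<lambda>z. 0) (\<lambda>_. 0)"
    by (rule simulable_const)
  have "simulable (Suc (Suc (Suc 0)))
      (\<lambda>z. (\<lambda>z. z ! 0 + z ! 1) (map (\<lambda>g. g z) [\<lambda>z. z ! 1, \<lambda>z. z ! 2])) (\<lambda>z. z ! 1 + z ! 2)"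
    by (rule simulable_comp[where V = sum_list])
      (use simulable_add in \<open>auto intro: simulable_proj\<close>)
  then show "simulable (Suc (Suc (Suc 0))) (\<lambda>z. z ! 1 + z ! 2) (\<lambda>z. z ! 1 + z ! 2)"
    by simp
  show "(j # (\<lambda>z. z ! 0 * z ! 1) (j # x) # x) ! 1 + (j # (\<lambda>z. z ! 0 * z ! 1) (j # x) # x) ! 2
      \<le> (y # x) ! 0 * (y # x) ! 1 + (y # x) ! 0" if "length x = Suc 0" "j < y"
    for j y :: nat and x :: "nat list"
    using mult_le_mono1[of "Suc j" y "x ! 0"] that by (simp add: numeral_2_eq_2)
qed (auto simp: numeral_2_eq_2)

text \<open>The factor \<open>3\<close> is chosen for the base case and survives the step:
  \<open>grz_h j\<close> at \<open>grz_h (Suc j) i\<close> is \<open>grz_h (Suc j) (Suc i)\<close>,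
  at most the value at \<open>y\<close> when \<open>i < y\<close>.\<close>

lemma simulable_grz_h:
  assumes "j \<ge> 1"
  shows "simulable (Suc 0) (\<lambda>z. grz_h j (z ! 0)) (\<lambda>z. 3 * grz_h j (z ! 0))"
  using assms
proof (induction j rule: dec_induct)
  case base
  have "simulable (Suc 0) (\<lambda>z. (\<lambda>z. z ! 0 * z ! 1) (map (\<lambda>g. g z) [\<lambda>z. z ! 0, \<lambda>z. z ! 0]))
      (\<lambda>z. z ! 0 * z ! 0 + z ! 0)"
    by (rule simulable_comp[where V = "\<lambda>z. z ! 0 * z ! 1 + z ! 0"])
      (use simulable_mult in \<open>auto intro: simulable_proj\<close>)
  then have "simulable (Suc 0) (\<lambda>z. z ! 0 * z ! 0) (\<lambda>z. z ! 0 * z ! 0 + z ! 0)"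
    by simp
  from simulable_Suc[OF simulable_Suc[OF this]]
  have "simulable (Suc 0) (\<lambda>z. grz_h 1 (z ! 0)) (\<lambda>z. z ! 0 * z ! 0 + z ! 0)"
    by (simp add: power2_eq_square)
  moreover have "z ! 0 * z ! 0 + z ! 0 \<le> 3 * grz_h 1 (z ! 0)" for z
    using Suc_le_square[of "z ! 0"] by (simp add: power2_eq_square)
  ultimately show ?case
    by (rule simulable_mono)
next
  case (step j)
  show ?case
  proof (rule simulable_rec)
    show "simulable 0 (\<lambda>z. 2) (\<lambda>_. 0)"
      by (rule simulable_const)
    have "simulable (Suc (Suc 0)) (\<lambda>z. (\<lambda>z. grz_h j (z ! 0)) (map (\<lambda>g. g z) [\<lambda>z. z ! 1]))
        (\<lambda>z. 3 * grz_h j (z ! 1))"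
      by (rule simulable_comp[where V = "\<lambda>z. 3 * grz_h j (z ! 0)"])
        (use step in \<open>auto intro: simulable_proj\<close>)
    then show "simulable (Suc (Suc 0)) (\<lambda>z. grz_h j (z ! 1)) (\<lambda>z. 3 * grz_h j (z ! 1))"
      by simp
    show "y \<le> 3 * grz_h (Suc j) ((y # x) ! 0)" for y x
      using Suc_le_grz_h[of "Suc j" y] by simp
    show "3 * grz_h j ((i # grz_h (Suc j) ((i # x) ! 0) # x) ! 1)
        \<le> 3 * grz_h (Suc j) ((y # x) ! 0)" if "i < y" for i y x
      using monoD[OF mono_grz_h[of "Suc j"], of "Suc i" y] that step.hyps
      by (simp add: grz_h_Suc)
  qed (use step.hyps in \<open>auto simp: grz_h_Suc\<close>)
qed

text \<open>A value bound is carried along because the thresholds of compositions and recursions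
  depend on intermediate values.\<close>

lemma Grz_simulable:
  assumes "(r, f) \<in> Grz (Suc d)" "d \<ge> 1"
  defines "U \<equiv> grz_h d"
  shows "\<exists>c. simulable r f (\<lambda>x. (U ^^ c) (sum_list x)) \<and>
    (\<forall>x. length x = r \<longrightarrow> f x \<le> (U ^^ c) (sum_list x))"
proof -
  note mono_U = mono_funpow_nat[OF mono_grz_h[OF assms(2), folded U_def]]
  have Suc_le_U: "Suc x \<le> U x" for x
    unfolding U_def by (rule Suc_le_grz_h[OF assms(2)])
  have U_exp: "(U ^^ i) x \<le> (U ^^ j) x" if "i \<le> j" for i j x
    using that by (intro funpow_le_exponent) (auto intro: Suc_leD Suc_le_U)
  have le_U: "x \<le> (U ^^ i) x" for i x
    using U_exp[of 0 i x] by simp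
  have mult_le_U: "i * x \<le> (U ^^ i) x" for i x
  proof -
    have "2 ^ i * x \<le> (U ^^ i) x"
    proof (induction i)
      case (Suc i)
      then show ?case
        using double_le_grz_h[OF assms(2), of "(U ^^ i) x"] by (simp add: U_def)
    qed simp
    moreover have "i * x \<le> 2 ^ i * x"
      using less_exp[of i] by (intro mult_le_mono1) simp
    ultimately show ?thesis by (rule order.trans[rotated])
  qed
  show ?thesis
    using assms(1)
  proof (induction rule: Grz.induct)
    case zero
    show ?case by (auto intro: simulable_const)
  next
    case succ
    have "simulable (Suc 0) (\<lambda>x. Suc (x ! 0)) (\<lambda>x. (U ^^ 1) (sum_list x))"
      by (intro simulable_Suc simulable_proj) simp
    then show ?case
      using Suc_le_U by (intro exI[of _ 1]) (auto simp: length_Suc_conv)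
  next
    case (proj i r)
    then show ?case
      by (intro exI[of _ 0]) (auto intro: simulable_proj elem_le_sum_list)
  next
    case (gen j)
    have le: "grz_h j x \<le> U x" for x
      unfolding U_def using gen by (intro grz_h_mono_index) auto
    \<comment> \<open>Three iterations absorb the factor \<open>3\<close>; a fourth replaces
      \<open>grz_h j\<close> by \<open>U\<close>.\<close>
    have "3 * grz_h j x \<le> (U ^^ 4) x" for x
    proof -
      have "3 * grz_h j x \<le> (U ^^ 3) (grz_h j x)"
        by (rule mult_le_U)
      also have "\<dots> \<le> (U ^^ 3) ((U ^^ 1) x)"
        using le by (intro monoD[OF mono_U]) simp
      also have "\<dots> = (U ^^ (3 + 1)) x"
        by (simp only: funpow_add comp_def)
      finally show ?thesis by simp
    qed
    then have *: "3 * grz_h j (x ! 0) \<le> (U ^^ 4) (sum_list x)" if "length x = Suc 0" for x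
      using that by (auto simp: length_Suc_conv simp del: funpow.simps)
    then have "simulable (Suc 0) (\<lambda>x. grz_h j (x ! 0)) (\<lambda>x. (U ^^ 4) (sum_list x))"
      using gen by (intro simulable_mono[OF simulable_grz_h]) auto
    moreover have "grz_h j (x ! 0) \<le> (U ^^ 4) (sum_list x)" if "length x = Suc 0" for x
      using *[OF that] by linarith
    ultimately show ?case by auto
  next
    case (comp gs h r)
    obtain c where c: "simulable (length gs) h (\<lambda>x. (U ^^ c) (sum_list x))"
      "\<And>x. length x = length gs \<Longrightarrow> h x \<le> (U ^^ c) (sum_list x)"
      using comp by blast
    obtain e where e: "\<And>g. g \<in> set gs \<Longrightarrow> simulable r g (\<lambda>x. (U ^^ e g) (sum_list x))"
      "\<And>g x. g \<in> set gs \<Longrightarrow> length x = r \<Longrightarrow> g x \<le> (U ^^ e g) (sum_list x)"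
      using comp.IH(2) by metis
    define d where "d = Max (e ` set gs)"
    have d: "e g \<le> d" if "g \<in> set gs" for g
      using that by (simp add: d_def)
    \<comment> \<open>The new \<open>d\<close> bounds every inner function, \<open>length gs\<close>
      absorbs their sum, and \<open>c\<close> belongs to \<open>h\<close>.\<close>
    let ?C = "c + (length gs + d)"
    have *: "(U ^^ c) (sum_list (map (\<lambda>g. g x) gs)) \<le> (U ^^ ?C) (sum_list x)"
      if x: "length x = r" for x
    proof -
      have "sum_list (map (\<lambda>g. g x) gs) \<le> sum_list (map (\<lambda>g. (U ^^ d) (sum_list x)) gs)"
        by (intro sum_list_mono) (use e(2) x U_exp d order.trans in blast)
      also have "\<dots> = length gs * (U ^^ d) (sum_list x)"
        by (simp add: sum_list_triv)
      also have "\<dots> \<le> (U ^^ length gs) ((U ^^ d) (sum_list x))"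
        by (rule mult_le_U)
      finally have "(U ^^ c) (sum_list (map (\<lambda>g. g x) gs))
          \<le> (U ^^ c) ((U ^^ length gs) ((U ^^ d) (sum_list x)))"
        by (intro monoD[OF mono_U])
      then show ?thesis
        by (simp only: funpow_add comp_def)
    qed
    have "simulable r (\<lambda>x. h (map (\<lambda>g. g x) gs)) (\<lambda>x. (U ^^ ?C) (sum_list x))"
    proof (rule simulable_comp[OF c(1)])
      fix g assume g: "g \<in> set gs"
      show "simulable r g (\<lambda>x. (U ^^ ?C) (sum_list x))"
        by (rule simulable_mono[OF e(1)[OF g]], rule U_exp) (use d[OF g] in simp)
    qed (rule *)
    moreover have "h (map (\<lambda>g. g x) gs) \<le> (U ^^ ?C) (sum_list x)" if "length x = r" for x
      using c(2)[of "map (\<lambda>g. g x) gs"] *[OF that] by simp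
    ultimately show ?case by blast
  next
    case (bounded_rec r g h b f)
    obtain cg where cg: "simulable r g (\<lambda>x. (U ^^ cg) (sum_list x))"
      using bounded_rec by blast
    obtain ch where ch: "simulable (Suc (Suc r)) h (\<lambda>x. (U ^^ ch) (sum_list x))"
      using bounded_rec by blast
    obtain cb where cb: "\<And>x. length x = Suc r \<Longrightarrow> b x \<le> (U ^^ cb) (sum_list x)"
      using bounded_rec by blast
    \<comment> \<open>Here the bound of the recursion enters: it keeps the values of
      \<open>f\<close> below a fixed iterate.\<close>
    have f_le: "f x \<le> (U ^^ cb) (sum_list x)" if "length x = Suc r" for x
      using that cb[OF that] bounded_rec.hyps(6) by (cases x) (auto intro: order.trans)
    \<comment> \<open>The \<open>2\<close> doubles the bound: the arguments of \<open>h\<close> are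
      a value of \<open>f\<close> and entries with sum at most
      \<open>sum_list (y # x)\<close>.\<close>
    let ?C = "ch + (2 + cb) + cg"
    have "simulable (Suc r) f (\<lambda>x. (U ^^ ?C) (sum_list x))"
    proof (rule simulable_rec[OF cg ch])
      fix y and x :: "nat list" assume x: "length x = r"
      show "y \<le> (U ^^ ?C) (sum_list (y # x))"
        using le_U[of "sum_list (y # x)" ?C] by simp
      have "(U ^^ cg) (sum_list x) \<le> (U ^^ cg) (sum_list (y # x))"
        by (intro monoD[OF mono_U]) simp
      also have "\<dots> \<le> (U ^^ ?C) (sum_list (y # x))"
        by (rule U_exp) simp
      finally show "(U ^^ cg) (sum_list x) \<le> (U ^^ ?C) (sum_list (y # x))" .
      fix j assume j: "j < y"
      let ?v = "(U ^^ cb) (sum_list (y # x))"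
      have "f (j # x) \<le> (U ^^ cb) (sum_list (j # x))"
        using x by (intro f_le) simp
      also have "\<dots> \<le> ?v"
        using j by (intro monoD[OF mono_U]) simp
      finally have "sum_list (j # f (j # x) # x) \<le> 2 * ?v"
        using le_U[of "sum_list (y # x)" cb] j by simp
      also have "\<dots> \<le> (U ^^ 2) ?v"
        by (rule mult_le_U)
      finally have "(U ^^ ch) (sum_list (j # f (j # x) # x)) \<le> (U ^^ ch) ((U ^^ 2) ?v)"
        by (intro monoD[OF mono_U])
      also have "\<dots> = (U ^^ (ch + (2 + cb))) (sum_list (y # x))"
        by (simp only: funpow_add comp_def)
      also have "\<dots> \<le> (U ^^ ?C) (sum_list (y # x))"
        by (rule U_exp) simp
      finally show "(U ^^ ch) (sum_list (j # f (j # x) # x)) \<le> (U ^^ ?C) (sum_list (y # x))" .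
    qed (use bounded_rec.hyps in auto)
    moreover have "f x \<le> (U ^^ ?C) (sum_list x)" if "length x = Suc r" for x
      using f_le[OF that] U_exp[of cb ?C "sum_list x"] by simp
    ultimately show ?case by blast
  next
    case (dom_ext r f f')
    then show ?case by (metis simulable_cong)
  qed
qed

text \<open>Iterating \<open>H\<close> on the sum of the arguments computes a sufficient
  \<open>w\<close> in normal position; the arguments themselves are then fed to the safe
  positions.\<close>

lemma Grz_subset_PredR:
  assumes H: "pred_class A 0 (Suc 0) 0 H" and le: "\<And>n. grz_h d n \<le> H [] [n] []" and "d \<ge> 1"
  shows "Grz (Suc d) \<subseteq> PredR A"
proof
  fix F assume "F \<in> Grz (Suc d)"
  then obtain r f where F: "F = (r, f)" "(r, f) \<in> Grz (Suc d)"
    by (cases F) auto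
  obtain c where "simulable r f (\<lambda>x. (grz_h d ^^ c) (sum_list x))"
    using Grz_simulable[OF F(2) assms(3)] by blast
  then obtain f' where f': "pred_class A 0 (Suc 0) r f'"
    "\<And>x w. length x = r \<Longrightarrow> (grz_h d ^^ c) (sum_list x) \<le> w \<Longrightarrow> f' [] [w] x = f x"
    unfolding simulable_def by blast
  define W where "W = (\<lambda>i n. ((\<lambda>v. H [] [v] []) ^^ i) (sum_list n))"
  have W: "pred_class A 0 r 0 (\<lambda>\<mu> n a. W i n)" for i
  proof (induction i)
    case 0
    show ?case using pred_class_sum_list by (simp add: W_def)
  next
    case (Suc i)
    show ?case
      by (rule pred_class_comp[OF H, where ss = "[\<lambda>\<mu> n a. W i n]" and ts = "[]"])
        (use Suc in \<open>auto simp: W_def args_def\<close>)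
  qed
  have W_ge: "(grz_h d ^^ i) (sum_list n) \<le> W i n" for i n
  proof (induction i)
    case (Suc i)
    have "grz_h d ((grz_h d ^^ i) (sum_list n)) \<le> grz_h d (W i n)"
      by (rule monoD[OF mono_grz_h[OF assms(3)] Suc])
    then show ?case
      using le[of "W i n"] by (simp add: W_def)
  qed (simp add: W_def)
  have "pred_class A 0 r 0 (\<lambda>\<mu> n a. f' [] [W c n] n)"
    by (rule pred_class_comp[OF f'(1), where ss = "[\<lambda>\<mu> n a. W c n]"
          and ts = "map (\<lambda>i \<mu> n a. n ! i) [0..<r]"])
      (auto simp: args_def comp_def map_nth_length intro: W pred_class.proj_normal)
  moreover have "f n = f' [] [W c n] n" if "length n = r" for n
    using f'(2)[OF that W_ge] by simp
  ultimately show "F \<in> PredR A"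
    unfolding PredR_def F(1) by blast
qed

end

section \<open>Dominating functions from members of \<open>A\<close>\<close>

lemma pred_class_slow_const:
  assumes "\<beta> \<in> A" "pred_class A 0 (Suc 0) 0 s"
  shows "pred_class A 0 (Suc 0) 0 (\<lambda>\<mu> n a. slow \<beta> (s \<mu> n []))"
proof -
  have "pred_class A 0 (Suc 0) 0 (\<lambda>\<mu> n a. slow ((\<beta> # \<mu>) ! 0) (n ! 0))"
    by (rule pred_class.const_subst[OF pred_class_slow assms(1)]) simp
  then show ?thesis
    by (rule pred_class_comp[where ss = "[s]" and ts = "[]"]) (use assms(2) in auto)
qed

lemma onat_mem_D_omega: "onat m \<in> D omega"
proof -
  have "prec1 (onat m) (onat (m + 1))"
    using prec1.intros(1)[of "onat m"] by simp
  moreover have "prec1 (onat (m + 1)) omega"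
    unfolding omega_def using prec1.intros(2)[of "\<lambda>i. onat (i + 1)" m] .
  ultimately show ?thesis
    by (simp add: D_def tranclp.trancl_into_trancl)
qed

theorem theorem8p10:
  fixes A :: "cord set"
  assumes "downset A"
    and "A \<subseteq> Phi_omega"
    and "bounded_ord A"
    and "\<not> A \<subseteq> D omega"
  shows "Grz (level A + 2) \<subseteq> PredR A"
proof -
  obtain \<alpha> where \<alpha>: "\<alpha> \<in> A" "\<alpha> \<notin> D omega"
    using assms(4) by blast
  then have "\<alpha> \<in> Phi_omega" "\<nexists>m. \<alpha> = onat m"
    using onat_mem_D_omega assms(2) by auto
  then have "\<forall>n. n \<le> slow \<alpha> n"
    using Phi_omega_cases_slow[of \<alpha>] by simp
  then interpret superlinear_ord A \<alpha>
    using \<alpha>(1) by unfold_locales auto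
  have proj: "pred_class A 0 (Suc 0) 0 (\<lambda>\<mu> n a. n ! 0)"
    by (rule pred_class.proj_normal) simp
  \<comment> \<open>The last generator of \<open>Grz (level A + 2)\<close> has index
    \<open>Suc (level A)\<close>, so a majorant of it suffices.\<close>
  have "\<exists>H. pred_class A 0 (Suc 0) 0 H \<and> (\<forall>n. grz_h (Suc (level A)) n \<le> H [] [n] [])"
  proof (cases "A \<subseteq> Psi_omega")
    case True
    then show ?thesis
      using pred_class_square_add_2
      by (intro exI[of _ "\<lambda>\<mu> n a. (n ! 0) ^ 2 + 2"]) (simp add: level_def)
  next
    case False
    then obtain \<beta> where \<beta>: "\<beta> \<in> A" "\<beta> \<notin> Psi_omega" by blast
    have level: "level A = (LEAST k. k \<ge> 1 \<and> A \<subseteq> Phi k)"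
      using False by (simp add: level_def)
    have level_ge: "level A \<ge> 1"
      unfolding level by (rule LeastI2_ex) (use assms(3) bounded_ord_def in auto)
    show ?thesis
    proof (cases "level A = 1")
      case True
      \<comment> \<open>The shift by three meets the restriction \<open>n \<ge> 3\<close> of the
        bound outside \<open>Psi_omega\<close>; nesting \<open>?G\<close> gives the double
        exponential needed for \<open>grz_h 2\<close>.\<close>
      let ?G = "\<lambda>n. slow \<beta> (Suc (Suc (Suc n)))"
      have G: "3 ^ n \<le> ?G n" for n
      proof -
        have "(3 :: nat) ^ n \<le> 3 ^ (n + 3)"
          by (intro power_increasing) auto
        also have "\<dots> \<le> Suc (n + 3) ^ (n + 3)"
          by (intro power_mono) auto
        also have "\<dots> \<le> slow \<beta> (n + 3)"
          using \<beta> assms(2) by (intro slow_ge_outside_Psi_omega) auto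
        finally show ?thesis by (simp only: numeral_3_eq_3 add_Suc_right add_0_right)
      qed
      have "pred_class A 0 (Suc 0) 0 (\<lambda>\<mu> n a. ?G (?G (n ! 0)))"
        by (rule pred_class_slow_const[where s = "\<lambda>\<mu> n a. Suc (Suc (Suc (?G (n ! 0))))"],
            rule \<beta>(1), (rule pred_class_Suc)+,
            rule pred_class_slow_const[where s = "\<lambda>\<mu> n a. Suc (Suc (Suc (n ! 0)))"],
            rule \<beta>(1), (rule pred_class_Suc)+, rule proj)
      moreover have "grz_h (Suc (level A)) n \<le> ?G (?G n)" for n
      proof -
        have "grz_h 2 n \<le> 2 ^ 3 ^ n"
          by (rule grz_h_2_le)
        also have "\<dots> \<le> 2 ^ ?G n"
          by (intro power_increasing G) auto
        also have "\<dots> \<le> 3 ^ ?G n"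
          by (intro power_mono) auto
        also have "\<dots> \<le> ?G (?G n)"
          by (rule G)
        finally show ?thesis unfolding True numeral_2_eq_2 One_nat_def .
      qed
      ultimately show ?thesis
        by (intro exI[of _ "\<lambda>\<mu> n a. ?G (?G (n ! 0))"]) simp
    next
      case False
      define k where "k = level A - 2"
      have k: "level A = Suc (Suc k)"
        using level_ge False by (simp add: k_def)
      \<comment> \<open>Minimality of the level, whose predecessor \<open>Suc k\<close> is still at
        least \<open>1\<close>.\<close>
      have "\<not> A \<subseteq> Phi (Suc k)"
        using not_less_Least[of "Suc k" "\<lambda>k. k \<ge> 1 \<and> A \<subseteq> Phi k"] k level by simp
      then obtain \<gamma> where \<gamma>: "\<gamma> \<in> A" "\<gamma> \<notin> Phi (Suc k)" by blast
      \<comment> \<open>This is the diagonal index \<open>2 * n + 2\<close>, written as a sum of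
        normal arguments.\<close>
      let ?s = "\<lambda>(\<mu> :: cord list) n (a :: nat list). Suc (Suc (n ! 0 + n ! 0))"
      have "pred_class A 0 (Suc 0) 0 (\<lambda>\<mu> n a. slow \<gamma> (?s \<mu> n []))"
        by (rule pred_class_slow_const[where s = ?s], rule \<gamma>(1), (rule pred_class_Suc)+,
            rule pred_class_add[where s = "\<lambda>\<mu> n a. n ! 0"]) (rule proj)+
      moreover have "grz_h (Suc (level A)) n \<le> slow \<gamma> (?s [] [n] [])" for n
      proof -
        have "grz_h (k + 3) n \<le> veblen_slow (Suc k) (2 * n + 2) 0"
          by (rule grz_h_le_veblen_slow_zero)
        also have "\<dots> \<le> slow \<gamma> (2 * n + 2)"
          using \<gamma> assms(2) by (intro slow_ge_outside_Phi) auto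
        also have "2 * n + 2 = ?s [] [n] []"
          by simp
        also have "k + 3 = Suc (level A)"
          using k by simp
        finally show ?thesis .
      qed
      ultimately show ?thesis
        by (intro exI[of _ "\<lambda>\<mu> n a. slow \<gamma> (?s \<mu> n [])"]) simp
    qed
  qed
  then obtain H where "pred_class A 0 (Suc 0) 0 H" "\<And>n. grz_h (Suc (level A)) n \<le> H [] [n] []"
    by blast
  then show ?thesis
    using Grz_subset_PredR[of H "Suc (level A)"] by simp
qed

end
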